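(* For the class of network contribution games with uniform budgets in which all reward functions are of the form $f_e(x,y)=h_e(\min(x,y))$ with convex $h_e$, the price of anarchy and the price of stability for pairwise equilibria are both exactly $2$.
   Context: Network contribution game: a finite simple undirected graph $G=(V,E)$; every node $v\in V$ is a player with budget $B_v\ge 0$. Let $E_v$ be the set of edges incident to $v$. A strategy of $v$ is a function $s_v:E_v\to\mathbb{R}_{\ge 0}$ with $\sum_{e\in E_v}s_v(e)\le B_v$; a state $s=(s_v)_{v\in V}$ consists of one strategy per player. Each edge $e=(u,v)$ has a reward function $f_e:\mathbb{R}_{\ge 0}^2\to\mathbb{R}_{\ge 0}$; here $f_e(x,y)=h_e(\min(x,y))$ with $h_e:\mathbb{R}_{\ge0}\to\mathbb{R}_{\ge0}$ nondecreasing. The utility of $v$ is $w_v(s)=\sum_{e=(v,u)\in E_v}f_e(s_v(e),s_u(e))$, and the social welfare is $w(s)=\sum_{v\in V}w_v(s)$. A social optimum $s^*$ is a state maximizing $w$. Budgets are uniform if $B_u=B_v$ for all $u,v\in V$; they are then normalized to $B_v=1$. A state $s$ is a (pure) Nash equilibrium if $w_v(s)\ge w_v(s_v',s_{-v})$ for every player $v$ and every strategy $s_v'$. An improving bilateral deviation in $s$ is a pair of strategies $(s_u',s_v')$ of two players $u\neq v$ with $w_u(s_u',s_v',s_{-u,v})>w_u(s)$ and $w_v(s_u',s_v',s_{-u,v})>w_v(s)$. A pairwise equilibrium is a Nash equilibrium that admits no improving bilateral deviation. For a game with pairwise equilibria, the price of anarchy (stability) for pairwise equilibria is the ratio $w(s^*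 )/w(s)$ for the worst (best) pairwise equilibrium $s$, i.e. the one with smallest (largest) welfare. For a class of games it is the worst (supremum) value over all games in the class. *)

theory Defs
  imports "HOL-Analysis.Analysis"
begin

text \<open>An undirected edge is a two-element vertex set. The first numerical argument of
  \<open>reward G e\<close> is the contribution of the player whose utility is evaluated, the second one
  that of the other endpoint; for the minimum-effort rewards below the order is immaterial.\<close>

record 'v contribution_game =
  verts :: "'v set"
  edges :: "'v set set"
  budget :: "'v \<Rightarrow> real"
  reward :: "'v set \<Rightarrow> real \<Rightarrow> real \<Rightarrow> real"

definition contribution_game :: "'v contribution_game \<Rightarrow> bool" where
  "contribution_game G \<longleftrightarrow>
     finite (verts G) \<and>
     edges G \<subseteq> {{u, v} | u v. u \<in> verts G \<and> v \<in> verts G \<and> u \<noteq> v} \<and>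
     (\<forall>v\<in>verts G. 0 \<le> budget G v) \<and>
     (\<forall>e\<in>edges G. \<forall>x\<ge>0. \<forall>y\<ge>0. 0 \<le> reward G e x y)"

definition incident :: "'v contribution_game \<Rightarrow> 'v \<Rightarrow> 'v set set" where
  "incident G v = {e \<in> edges G. v \<in> e}"

text \<open>Strategies and states are total functions; only the values of \<open>s v\<close> on \<open>incident G v\<close>,
  for vertices \<open>v\<close> of \<open>G\<close>, are constrained, and only these enter the utilities.\<close>

definition strategy :: "'v contribution_game \<Rightarrow> 'v \<Rightarrow> ('v set \<Rightarrow> real) \<Rightarrow> bool" where
  "strategy G v x \<longleftrightarrow>
     (\<forall>e\<in>incident G v. 0 \<le> x e) \<and> (\<Sum>e\<in>incident G v. x e) \<le> budget G v"

definition state :: "'v contribution_game \<Rightarrow> ('v \<Rightarrow> 'v set \<Rightarrow> real) \<Rightarrow> bool" where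
  "state G s \<longleftrightarrow> (\<forall>v\<in>verts G. strategy G v (s v))"

text \<open>The sum over the edges at \<open>v\<close> is indexed by their other endpoint \<open>u\<close>.\<close>

definition utility :: "'v contribution_game \<Rightarrow> ('v \<Rightarrow> 'v set \<Rightarrow> real) \<Rightarrow> 'v \<Rightarrow> real" where
  "utility G s v = (\<Sum>u | {v, u} \<in> edges G. reward G {v, u} (s v {v, u}) (s u {v, u}))"

definition welfare :: "'v contribution_game \<Rightarrow> ('v \<Rightarrow> 'v set \<Rightarrow> real) \<Rightarrow> real" where
  "welfare G s = (\<Sum>v\<in>verts G. utility G s v)"

definition social_optimum :: "'v contribution_game \<Rightarrow> ('v \<Rightarrow> 'v set \<Rightarrow> real) \<Rightarrow> bool" where
  "social_optimum G s \<longleftrightarrow> state G s \<and> (\<forall>t. state G t \<longrightarrow> welfare G t \<le> welfare G s)"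

definition nash_equilibrium :: "'v contribution_game \<Rightarrow> ('v \<Rightarrow> 'v set \<Rightarrow> real) \<Rightarrow> bool" where
  "nash_equilibrium G s \<longleftrightarrow> state G s \<and>
     (\<forall>v\<in>verts G. \<forall>x. strategy G v x \<longrightarrow> utility G (s(v := x)) v \<le> utility G s v)"

definition improving_bilateral_deviation ::
  "'v contribution_game \<Rightarrow> ('v \<Rightarrow> 'v set \<Rightarrow> real) \<Rightarrow> 'v \<Rightarrow> ('v set \<Rightarrow> real) \<Rightarrow>
   'v \<Rightarrow> ('v set \<Rightarrow> real) \<Rightarrow> bool" where
  "improving_bilateral_deviation G s u x v y \<longleftrightarrow>
     u \<in> verts G \<and> v \<in> verts G \<and> u \<noteq> v \<and> strategy G u x \<and> strategy G v y \<and>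
     utility G s u < utility G (s(u := x, v := y)) u \<and>
     utility G s v < utility G (s(u := x, v := y)) v"

definition pairwise_equilibrium :: "'v contribution_game \<Rightarrow> ('v \<Rightarrow> 'v set \<Rightarrow> real) \<Rightarrow> bool" where
  "pairwise_equilibrium G s \<longleftrightarrow> nash_equilibrium G s \<and>
     (\<nexists>u x v y. improving_bilateral_deviation G s u x v y)"

text \<open>The ratio \<open>a / b\<close> of two nonnegative welfare values, with \<open>0 / 0 = 1\<close> (every state is
  optimal) and \<open>a / 0 = \<infinity>\<close> for \<open>a > 0\<close>.\<close>

definition welfare_ratio :: "real \<Rightarrow> real \<Rightarrow> ennreal" where
  "welfare_ratio a b = (if a = 0 \<and> b = 0 then 1 else ennreal a / ennreal b)"

text \<open>All social optima of a game have the same welfare, so \<open>t\<close> below only ranges over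
  different witnesses of the same value.\<close>

definition price_of_anarchy :: "'v contribution_game \<Rightarrow> ennreal" where
  "price_of_anarchy G =
     Sup {welfare_ratio (welfare G t) (welfare G s) | t s.
            social_optimum G t \<and> pairwise_equilibrium G s}"

definition price_of_stability :: "'v contribution_game \<Rightarrow> ennreal" where
  "price_of_stability G =
     Inf {welfare_ratio (welfare G t) (welfare G s) | t s.
            social_optimum G t \<and> pairwise_equilibrium G s}"

text \<open>For a class of games, the prices range over those members that have a pairwise
  equilibrium.\<close>

definition class_price_of_anarchy :: "'v contribution_game set \<Rightarrow> ennreal" where
  "class_price_of_anarchy \<C> =
     (SUP G \<in> {G \<in> \<C>. \<exists>s. pairwise_equilibrium G s}. price_of_anarchy G)"

definition class_price_of_stability :: "'v contribution_game set \<Rightarrow> ennreal" where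
  "class_price_of_stability \<C> =
     (SUP G \<in> {G \<in> \<C>. \<exists>s. pairwise_equilibrium G s}. price_of_stability G)"

definition uniform_budgets :: "'v contribution_game \<Rightarrow> bool" where
  "uniform_budgets G \<longleftrightarrow> (\<forall>u\<in>verts G. \<forall>v\<in>verts G. budget G u = budget G v)"

definition normalized_budgets :: "'v contribution_game \<Rightarrow> bool" where
  "normalized_budgets G \<longleftrightarrow> (\<forall>v\<in>verts G. budget G v = 1)"

definition convex_min_effort :: "'v contribution_game \<Rightarrow> bool" where
  "convex_min_effort G \<longleftrightarrow>
     (\<forall>e\<in>edges G. \<exists>h :: real \<Rightarrow> real.
        (\<forall>x\<ge>0. 0 \<le> h x) \<and> mono_on {0..} h \<and> convex_on {0..} h \<and>
        (\<forall>x\<ge>0. \<forall>y\<ge>0. reward G e x y = h (min x y)))"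

definition uniform_convex_games :: "'v contribution_game set" where
  "uniform_convex_games =
     {G. contribution_game G \<and> uniform_budgets G \<and> convex_min_effort G}"

end

theory Submission
  imports Defs
begin

text \<open>Upper bound: in a pairwise equilibrium \<open>s\<close>, the endpoints of an edge \<open>e\<close> do not both
  gain by moving their whole budget \<open>B\<close> to \<open>e\<close>, so \<open>h\<^sub>e(B) - h\<^sub>e(0)\<close> is at most the
  sum of the endpoints' utilities in excess of the constants \<open>h(0)\<close>. By convexity, any other state
  collects from \<open>e\<close> at most the fraction \<open>x\<^sub>e / B\<close> of this difference, and these fractions
  sum to at most \<open>1\<close> at every vertex, so each equilibrium utility is charged at most twice.

  Lower bound: on a path with three edges and rewards \<open>min\<close>, \<open>(1 + \<epsilon>) min\<close>, \<open>min\<close>, every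
  pairwise equilibrium uses only the middle edge, while the two outer edges yield welfare \<open>4\<close>.\<close>

section \<open>The upper bound\<close>

text \<open>Fixing one \<open>h e\<close> per edge and one budget \<open>B\<close> unpacks the
  existential in \<open>convex_min_effort\<close> and the comparison of budgets once and for
  all.\<close>

locale convex_game =
  fixes G :: "'v contribution_game" and h :: "'v set \<Rightarrow> real \<Rightarrow> real" and B :: real
  assumes game: "contribution_game G"
    and B_nonneg: "0 \<le> B"
    and budget: "v \<in> verts G \<Longrightarrow> budget G v = B"
    and h_nonneg: "e \<in> edges G \<Longrightarrow> 0 \<le> x \<Longrightarrow> 0 \<le> h e x"
    and h_mono: "e \<in> edges G \<Longrightarrow> mono_on {0..} (h e)"
    and h_convex: "e \<in> edges G \<Longrightarrow> convex_on {0..} (h e)"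
    and reward: "e \<in> edges G \<Longrightarrow> 0 \<le> x \<Longrightarrow> 0 \<le> y \<Longrightarrow> reward G e x y = h e (min x y)"
begin

section \<open>Neighbourhoods and double counting\<close>

definition nbrs :: "'v \<Rightarrow> 'v set" where
  "nbrs v = {u. {v, u} \<in> edges G}"

lemma edgeD:
  assumes "{u, v} \<in> edges G"
  shows "u \<in> verts G" "v \<in> verts G" "u \<noteq> v"
  using assms game by (auto simp: contribution_game_def doubleton_eq_iff)

lemma edgeE:
  assumes "e \<in> edges G"
  obtains u v where "e = {u, v}" "u \<in> verts G" "v \<in> verts G" "u \<noteq> v"
  using assms game by (auto simp: contribution_game_def)

lemma finite_verts: "finite (verts G)"
  using game by (simp add: contribution_game_def)

lemma finite_edges: "finite (edges G)"
proof (rule finite_subset)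
  show "edges G \<subseteq> Pow (verts G)"
    by (auto elim!: edgeE)
qed (simp add: finite_verts)

lemma finite_incident: "finite (incident G v)"
  by (simp add: incident_def finite_edges)

lemma nbrs_subset: "nbrs v \<subseteq> verts G"
  by (auto simp: nbrs_def dest: edgeD)

lemma finite_nbrs: "finite (nbrs v)"
  using nbrs_subset finite_verts by (rule finite_subset)

text \<open>Links budget constraints, summed over edges, with utilities, summed over neighbours: in
  a simple graph the two correspond one to one.\<close>

lemma sum_incident: "(\<Sum>e\<in>incident G v. f e) = (\<Sum>u\<in>nbrs v. f {v, u})"
proof -
  have "bij_betw (\<lambda>u. {v, u}) (nbrs v) (incident G v)"
  proof (rule bij_betwI')
    fix e assume "e \<in> incident G v"
    then have e: "e \<in> edges G" "v \<in> e"
      by (auto simp: incident_def)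
    obtain a b where "e = {a, b}"
      using e(1) by (rule edgeE)
    with e show "\<exists>u\<in>nbrs v. e = {v, u}"
      by (auto simp: nbrs_def insert_commute)
  qed (auto simp: nbrs_def incident_def doubleton_eq_iff)
  then show ?thesis
    by (rule sum.reindex_bij_betw[symmetric])
qed

text \<open>Adjacency is symmetric, so the ordered adjacent pairs may be enumerated from either
  end.\<close>

lemma sum_nbrs_swap:
  fixes f :: "'v \<Rightarrow> 'v \<Rightarrow> real"
  shows "(\<Sum>v\<in>verts G. \<Sum>u\<in>nbrs v. f v u) = (\<Sum>v\<in>verts G. \<Sum>u\<in>nbrs v. f u v)"
proof -
  have "(\<Sum>v\<in>verts G. \<Sum>u\<in>nbrs v. f v u) = (\<Sum>v\<in>verts G. \<Sum>u\<in>{u \<in> verts G. u \<in> nbrs v}. f v u)"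
    using nbrs_subset by (intro sum.cong) auto
  also have "\<dots> = (\<Sum>u\<in>verts G. \<Sum>v\<in>{v \<in> verts G. u \<in> nbrs v}. f v u)"
    by (rule sum.swap_restrict[OF finite_verts finite_verts])
  also have "\<dots> = (\<Sum>u\<in>verts G. \<Sum>v\<in>nbrs u. f v u)"
    using nbrs_subset by (intro sum.cong) (auto simp: nbrs_def insert_commute)
  finally show ?thesis .
qed

lemma state_nonneg:
  assumes "state G s" "{v, u} \<in> edges G"
  shows "0 \<le> s v {v, u}" "0 \<le> s u {v, u}"
  using assms edgeD[OF assms(2)] by (auto simp: state_def strategy_def incident_def)

lemma strategy_le_budget:
  assumes "strategy G v x" "v \<in> verts G" "e \<in> incident G v"
  shows "x e \<le> B"
proof -
  have "x e \<le> (\<Sum>e\<in>incident G v. x e)"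
    using assms by (intro member_le_sum finite_incident) (auto simp: strategy_def)
  then show ?thesis
    using assms budget by (auto simp: strategy_def)
qed

lemma utility_eq:
  assumes "state G s"
  shows "utility G s v = (\<Sum>u\<in>nbrs v. h {v, u} (min (s v {v, u}) (s u {v, u})))"
  unfolding utility_def nbrs_def
  using state_nonneg[OF assms] by (intro sum.cong) (auto simp: reward)

section \<open>Convexity bounds and guaranteed utility\<close>

lemma h_le:
  assumes "e \<in> edges G" "0 \<le> x" "x \<le> y"
  shows "h e x \<le> h e y"
  using h_mono[OF assms(1)] assms(2,3) by (auto intro: mono_onD)

text \<open>Convexity, with \<open>x\<close> as the mixture of \<open>0\<close> and \<open>B\<close>
  of weight \<open>x / B\<close>. If \<open>B = 0\<close>, then \<open>x = 0\<close> and both sides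
  agree.\<close>

lemma h_chord:
  assumes "e \<in> edges G" "0 \<le> x" "x \<le> B"
  shows "h e x \<le> h e 0 + x / B * (h e B - h e 0)"
proof (cases "B = 0")
  case False
  have "h e ((1 - x / B) *\<^sub>R 0 + (x / B) *\<^sub>R B) \<le> (1 - x / B) * h e 0 + (x / B) * h e B"
    using assms B_nonneg False by (intro convex_onD[OF h_convex]) (auto simp: field_simps)
  then show ?thesis
    using False by (simp add: algebra_simps)
qed (use assms in auto)

text \<open>The part of the utility of \<open>v\<close> that no state can take away, as
  \<open>h e 0\<close> may be positive.\<close>

definition base :: "'v \<Rightarrow> real" where
  "base v = (\<Sum>u\<in>nbrs v. h {v, u} 0)"

lemma base_nonneg: "0 \<le> base v"
  by (auto simp: base_def nbrs_def intro!: sum_nonneg h_nonneg)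

lemma base_le_utility:
  assumes "state G s"
  shows "base v \<le> utility G s v"
  unfolding base_def utility_eq[OF assms]
  using state_nonneg[OF assms] by (intro sum_mono h_le) (auto simp: nbrs_def)

lemma welfare_nonneg:
  assumes "state G s"
  shows "0 \<le> welfare G s"
  unfolding welfare_def
  by (rule sum_nonneg) (rule order_trans[OF base_nonneg base_le_utility[OF assms]])

section \<open>Moving the whole budget to one edge\<close>

definition all_in :: "'v set \<Rightarrow> 'v set \<Rightarrow> real" where
  "all_in e = (\<lambda>e'. if e' = e then B else 0)"

lemma strategy_all_in:
  assumes "v \<in> verts G"
  shows "strategy G v (all_in e)"
  using assms B_nonneg budget
  by (auto simp: strategy_def all_in_def sum.delta[OF finite_incident])

text \<open>On its other edges \<open>u\<close> contributes \<open>0\<close>, so the minimum is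
  \<open>0\<close> whatever the neighbours do; only the edge to \<open>v\<close> can pay more than
  its constant.\<close>

lemma utility_all_in:
  assumes "state G s" "{u, v} \<in> edges G" "s u = all_in {u, v}" "s v = all_in {u, v}"
  shows "utility G s u = base u + (h {u, v} B - h {u, v} 0)"
proof -
  have "utility G s u =
      (\<Sum>w\<in>nbrs u. h {u, w} 0 + (if w = v then h {u, v} B - h {u, v} 0 else 0))"
    unfolding utility_eq[OF assms(1)]
  proof (rule sum.cong)
    fix w assume "w \<in> nbrs u"
    then have "0 \<le> s w {u, w}"
      using state_nonneg[OF assms(1)] by (auto simp: nbrs_def)
    then show "h {u, w} (min (s u {u, w}) (s w {u, w})) =
        h {u, w} 0 + (if w = v then h {u, v} B - h {u, v} 0 else 0)"
      using assms(3,4) by (auto simp: all_in_def doubleton_eq_iff)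
  qed simp
  also have "\<dots> = base u + (h {u, v} B - h {u, v} 0)"
    using assms(2) finite_nbrs[of u] by (simp add: sum.distrib base_def nbrs_def sum.delta)
  finally show ?thesis .
qed

text \<open>One endpoint does not profit from the joint move to \<open>{u, v}\<close>, so its own
  excess already bounds the gain. Adding the other, nonnegative excess avoids asking which endpoint
  it is.\<close>

lemma gain_le_excess:
  assumes "pairwise_equilibrium G s" "{u, v} \<in> edges G"
  shows "h {u, v} B - h {u, v} 0 \<le> (utility G s u - base u) + (utility G s v - base v)"
proof -
  let ?x = "all_in {u, v}"
  let ?t = "s(u := ?x, v := ?x)"
  note uv = edgeD[OF assms(2)]
  have s: "state G s"
    using assms(1) by (auto simp: pairwise_equilibrium_def nash_equilibrium_def)
  have t: "state G ?t"
    using s uv strategy_all_in by (auto simp: state_def)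
  have "\<not> improving_bilateral_deviation G s u ?x v ?x"
    using assms(1) by (auto simp: pairwise_equilibrium_def)
  then have "utility G ?t u \<le> utility G s u \<or> utility G ?t v \<le> utility G s v"
    using uv strategy_all_in by (auto simp: improving_bilateral_deviation_def)
  moreover have "utility G ?t u = base u + (h {u, v} B - h {u, v} 0)"
    using utility_all_in[OF t assms(2)] uv by simp
  moreover have "utility G ?t v = base v + (h {u, v} B - h {u, v} 0)"
    using utility_all_in[OF t, of v u] assms(2) uv by (simp add: insert_commute)
  ultimately show ?thesis
    using base_le_utility[OF s, of u] base_le_utility[OF s, of v] by linarith
qed

lemma welfare_le_twice:
  assumes eq: "pairwise_equilibrium G s" and t: "state G t"
  shows "welfare G t \<le> 2 * welfare G s"
proof -
  have s: "state G s"
    using eq by (auto simp: pairwise_equilibrium_def nash_equilibrium_def)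
  \<comment> \<open>\<open>y v u\<close> is the share of the budget that \<open>t\<close> puts to
    effective use on an edge, \<open>W v\<close> the excess of \<open>v\<close> in the equilibrium.
    For \<open>B = 0\<close> all shares are \<open>0\<close>.\<close>
  define y where "y v u = min (t v {v, u}) (t u {v, u}) / B" for v u
  define W where "W v = utility G s v - base v" for v
  have W_nonneg: "0 \<le> W v" for v
    using base_le_utility[OF s] by (simp add: W_def)
  have y_sym: "y v u = y u v" for u v
    by (simp add: y_def insert_commute min.commute)
  have y_sum: "(\<Sum>u\<in>nbrs v. y v u) \<le> 1" if v: "v \<in> verts G" for v
  proof -
    have "(\<Sum>u\<in>nbrs v. min (t v {v, u}) (t u {v, u})) \<le> (\<Sum>u\<in>nbrs v. t v {v, u})"
      by (intro sum_mono) simp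
    also have "\<dots> \<le> B"
      using t v budget[OF v] by (auto simp: state_def strategy_def sum_incident)
    finally show ?thesis
      using B_nonneg by (cases "B = 0") (auto simp: y_def divide_simps simp flip: sum_divide_distrib)
  qed
  have util: "utility G t v \<le> base v + (\<Sum>u\<in>nbrs v. y v u * (W v + W u))"
    if v: "v \<in> verts G" for v
    unfolding base_def utility_eq[OF t] sum.distrib[symmetric]
  proof (rule sum_mono)
    fix u assume "u \<in> nbrs v"
    then have e: "{v, u} \<in> edges G"
      by (simp add: nbrs_def)
    note nonneg = state_nonneg[OF t e]
    have "t v {v, u} \<le> B"
      using t v e by (intro strategy_le_budget) (auto simp: state_def incident_def)
    then have "h {v, u} (min (t v {v, u}) (t u {v, u}))
        \<le> h {v, u} 0 + y v u * (h {v, u} B - h {v, u} 0)"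
      using nonneg unfolding y_def by (intro h_chord[OF e]) auto
    also have "\<dots> \<le> h {v, u} 0 + y v u * (W v + W u)"
      using nonneg B_nonneg gain_le_excess[OF eq e]
      by (intro add_left_mono mult_left_mono) (auto simp: W_def y_def)
    finally show "h {v, u} (min (t v {v, u}) (t u {v, u})) \<le> h {v, u} 0 + y v u * (W v + W u)" .
  qed
  \<comment> \<open>Shares at \<open>v\<close> sum to at most \<open>1\<close>, so
    \<open>W v\<close> is charged at most once from its own side; the swap below gives the same for
    charges from neighbours.\<close>
  have half: "(\<Sum>v\<in>verts G. \<Sum>u\<in>nbrs v. y v u * W v) \<le> (\<Sum>v\<in>verts G. W v)"
    using mult_right_mono[OF y_sum W_nonneg] by (intro sum_mono) (simp flip: sum_distrib_right)
  have "welfare G t \<le> (\<Sum>v\<in>verts G. base v + (\<Sum>u\<in>nbrs v. y v u * (W v + W u)))"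
    unfolding welfare_def by (rule sum_mono) (rule util)
  also have "\<dots> = (\<Sum>v\<in>verts G. base v) + (\<Sum>v\<in>verts G. \<Sum>u\<in>nbrs v. y v u * W v)
      + (\<Sum>v\<in>verts G. \<Sum>u\<in>nbrs v. y v u * W u)"
    by (simp add: sum.distrib distrib_left)
  also have "(\<Sum>v\<in>verts G. \<Sum>u\<in>nbrs v. y v u * W u) = (\<Sum>v\<in>verts G. \<Sum>u\<in>nbrs v. y v u * W v)"
    by (subst sum_nbrs_swap) (simp add: y_sym)
  also have "(\<Sum>v\<in>verts G. base v) + (\<Sum>v\<in>verts G. \<Sum>u\<in>nbrs v. y v u * W v)
      + (\<Sum>v\<in>verts G. \<Sum>u\<in>nbrs v. y v u * W v)
      \<le> (\<Sum>v\<in>verts G. base v) + 2 * (\<Sum>v\<in>verts G. W v)"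
    using half by simp
  \<comment> \<open>The constants \<open>base v\<close> are charged only once, so twice the
    equilibrium welfare exceeds the bound by their sum.\<close>
  also have "\<dots> = 2 * welfare G s - (\<Sum>v\<in>verts G. base v)"
    by (simp add: W_def welfare_def sum_subtractf)
  also have "\<dots> \<le> 2 * welfare G s"
    using sum_nonneg[of "verts G" base] base_nonneg by simp
  finally show ?thesis .
qed

section \<open>Existence of a social optimum\<close>

lemma continuous_reward:
  assumes "e \<in> edges G"
  shows "continuous_on UNIV (\<lambda>x. h e (max x 0))"
proof (rule convex_on_continuous)
  \<comment> \<open>Convexity gives continuity on open sets, and \<open>{0..}\<close> is not open.
    The constant extension to the left stays convex because \<open>h e\<close> is nondecreasing, so
    continuity holds at \<open>0\<close> too.\<close>
  show "convex_on UNIV (\<lambda>x. h e (max x 0))"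
  proof (rule convex_onI)
    fix t x y :: real assume t: "0 < t" "t < 1"
    have "max ((1 - t) * x + t * y) 0 \<le> (1 - t) * max x 0 + t * max y 0"
      using t by (auto intro!: add_mono mult_left_mono add_nonneg_nonneg mult_nonneg_nonneg)
    then have "h e (max ((1 - t) * x + t * y) 0) \<le> h e ((1 - t) * max x 0 + t * max y 0)"
      by (intro h_le[OF assms]) auto
    also have "\<dots> \<le> (1 - t) * h e (max x 0) + t * h e (max y 0)"
      using convex_onD[OF h_convex[OF assms], of t "max x 0" "max y 0"] t by simp
    finally show "h e (max ((1 - t) *\<^sub>R x + t *\<^sub>R y) 0) \<le> (1 - t) * h e (max x 0) + t * h e (max y 0)"
      by simp
  qed simp
qed simp

text \<open>Only the minimum of the two contributions to an edge matters, so it suffices to maximize over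
  states in which both endpoints contribute the same amount \<open>x e\<close>.\<close>

lemma social_optimum_exists: "\<exists>t. social_optimum G t"
proof -
  \<comment> \<open>Coordinates range over all vertex sets, so that \<open>K\<close> is a closed
    part of a full product of compact intervals, compact by Tychonoff.\<close>
  define K where "K = (\<Pi>\<^sub>E e\<in>UNIV. {0..B}) \<inter>
    (\<Inter>v\<in>verts G. {x. (\<Sum>e\<in>incident G v. x e) \<le> B})"
  \<comment> \<open>The \<open>max\<close> changes nothing on \<open>K\<close> and makes
    \<open>f\<close> continuous on the whole space.\<close>
  define f where "f x = (\<Sum>v\<in>verts G. \<Sum>u\<in>nbrs v. h {v, u} (max (x {v, u}) 0))"
    for x :: "'v set \<Rightarrow> real"
  have proj: "continuous_on UNIV (\<lambda>x :: 'v set \<Rightarrow> real. x e)" for e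
    by (rule continuous_on_product_coordinates)
  have "compactin (product_topology (\<lambda>e :: 'v set. euclidean) UNIV) (\<Pi>\<^sub>E e\<in>UNIV. {0..B})"
    by (simp add: compactin_PiE)
  then have "compact (\<Pi>\<^sub>E e\<in>(UNIV :: 'v set set). {0..B})"
    by (simp add: euclidean_product_topology)
  moreover have "closed (\<Inter>v\<in>verts G. {x :: 'v set \<Rightarrow> real. (\<Sum>e\<in>incident G v. x e) \<le> B})"
    using proj by (intro closed_INT ballI closed_Collect_le continuous_intros) auto
  ultimately have "compact K"
    unfolding K_def by (rule compact_Int_closed)
  moreover have "(\<lambda>e. 0) \<in> K"
    using B_nonneg by (auto simp: K_def)
  moreover have "continuous_on K f"
  proof (rule continuous_on_subset)
    show "continuous_on UNIV f"
      unfolding f_def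
      by (intro continuous_on_sum continuous_on_compose2[OF continuous_reward proj])
        (auto simp: nbrs_def)
  qed simp
  ultimately obtain x where x: "x \<in> K" and x_max: "\<And>y. y \<in> K \<Longrightarrow> f y \<le> f x"
    using continuous_attains_sup[of K f] by auto
  have x_state: "state G (\<lambda>v. x)"
    using x budget by (auto simp: K_def state_def strategy_def PiE_iff)
  have x_nonneg: "0 \<le> x e" for e
    using x by (auto simp: K_def PiE_iff)
  have x_welfare: "welfare G (\<lambda>v. x) = f x"
    using x_nonneg by (simp add: welfare_def utility_eq[OF x_state] f_def max_absorb1)
  have "welfare G t \<le> welfare G (\<lambda>v. x)" if t: "state G t" for t
  proof -
    \<comment> \<open>Lowering both contributions to an edge to their minimum keeps the welfare of
      \<open>t\<close> and respects the budgets; the value \<open>0\<close> off the edges keeps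
      \<open>y\<close> in \<open>K\<close>.\<close>
    define y where "y e = (if e \<in> edges G then Min ((\<lambda>v. t v e) ` e) else 0)" for e
    have y: "y {u, v} = min (t u {u, v}) (t v {u, v})" if "{u, v} \<in> edges G" for u v
      using that by (simp add: y_def)
    have "y e \<in> {0..B}" for e
    proof (cases "e \<in> edges G")
      case True
      then obtain u v where "e = {u, v}" "u \<in> verts G"
        by (rule edgeE)
      with True have e: "e = {u, v}" "u \<in> verts G" "{u, v} \<in> edges G"
        by auto
      then have "t u e \<le> B"
        using t by (intro strategy_le_budget[of u]) (auto simp: state_def incident_def)
      then show ?thesis
        using e y state_nonneg[OF t e(3)] by (auto simp: min_def)
    qed (use B_nonneg in \<open>simp add: y_def\<close>)
    moreover have "(\<Sum>e\<in>incident G v. y e) \<le> B" if v: "v \<in> verts G" for v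
    proof -
      have "(\<Sum>u\<in>nbrs v. y {v, u}) \<le> (\<Sum>u\<in>nbrs v. t v {v, u})"
        by (intro sum_mono) (auto simp: y nbrs_def)
      then show ?thesis
        using t v budget[OF v] by (auto simp: state_def strategy_def sum_incident)
    qed
    ultimately have "y \<in> K"
      by (auto simp: K_def)
    moreover have "welfare G t = f y"
      unfolding welfare_def utility_eq[OF t] f_def using state_nonneg[OF t]
      by (intro sum.cong) (auto simp: y nbrs_def max_absorb1)
    ultimately show ?thesis
      using x_max x_welfare by simp
  qed
  then show ?thesis
    using x_state by (auto simp: social_optimum_def)
qed

end

section \<open>Games of the class as instances of the locale, and bounds on their prices\<close>

lemma convex_game_exists:
  assumes "G \<in> uniform_convex_games"
  shows "\<exists>h B. convex_game G h B"
proof -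
  have G: "contribution_game G" "uniform_budgets G" "convex_min_effort G"
    using assms by (auto simp: uniform_convex_games_def)
  obtain B where B: "0 \<le> B" "\<And>v. v \<in> verts G \<Longrightarrow> budget G v = B"
  \<comment> \<open>Without vertices there is no budget to read off, and \<open>B = 0\<close> is
    taken.\<close>
  proof (cases "verts G = {}")
    case False
    then obtain v where "v \<in> verts G"
      by auto
    show ?thesis
    proof (rule that)
      show "0 \<le> budget G v"
        using G(1) \<open>v \<in> verts G\<close> by (simp add: contribution_game_def)
      show "budget G u = budget G v" if "u \<in> verts G" for u
        using G(2) \<open>v \<in> verts G\<close> that unfolding uniform_budgets_def by blast
    qed
  qed (rule that[of 0], auto)
  obtain h where "\<forall>e\<in>edges G. (\<forall>x\<ge>0. 0 \<le> h e x) \<and> mono_on {0..} (h e) \<and>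
      convex_on {0..} (h e) \<and> (\<forall>x\<ge>0. \<forall>y\<ge>0. reward G e x y = h e (min x y))"
    using bchoice[OF G(3)[unfolded convex_min_effort_def]] by blast
  then have "convex_game G h B"
    using G B by unfold_locales auto
  then show ?thesis
    by blast
qed

text \<open>If \<open>b = 0\<close>, the hypotheses force \<open>a = 0\<close>, and the ratio takes
  its default value \<open>1\<close>; this is where \<open>1 \<le> c\<close> enters.\<close>

lemma welfare_ratio_le:
  assumes "0 \<le> b" "1 \<le> c" "a \<le> c * b" "0 \<le> a"
  shows "welfare_ratio a b \<le> ennreal c"
proof (cases "b = 0")
  case False
  then have "welfare_ratio a b = ennreal (a / b)"
    using assms by (simp add: welfare_ratio_def divide_ennreal)
  also have "\<dots> \<le> ennreal c"
    using assms False by (intro ennreal_leI) (simp add: divide_simps)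
  finally show ?thesis .
qed (use assms in \<open>simp add: welfare_ratio_def\<close>)

lemma price_of_anarchy_le:
  assumes "G \<in> uniform_convex_games"
  shows "price_of_anarchy G \<le> 2"
proof -
  obtain h B where "convex_game G h B"
    using convex_game_exists[OF assms] by auto
  then interpret convex_game G h B .
  have "welfare_ratio (welfare G t) (welfare G s) \<le> ennreal 2"
    if "social_optimum G t" "pairwise_equilibrium G s" for t s
  proof (rule welfare_ratio_le)
    have "state G t" "state G s"
      using that by (auto simp: social_optimum_def pairwise_equilibrium_def nash_equilibrium_def)
    then show "welfare G t \<le> 2 * welfare G s" "0 \<le> welfare G t" "0 \<le> welfare G s"
      using welfare_le_twice that(2) welfare_nonneg by auto
  qed auto
  then show ?thesis
    unfolding price_of_anarchy_def by (auto intro!: Sup_least)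
qed

text \<open>The infimum over no ratios would be infinite, so a social optimum must exist beside the
  equilibrium; the compactness argument provides it.\<close>

lemma price_of_stability_le_anarchy:
  assumes "G \<in> uniform_convex_games" "pairwise_equilibrium G s"
  shows "price_of_stability G \<le> price_of_anarchy G"
proof -
  obtain h B where "convex_game G h B"
    using convex_game_exists[OF assms(1)] by auto
  then obtain t where "social_optimum G t"
    using convex_game.social_optimum_exists by blast
  then show ?thesis
    unfolding price_of_stability_def price_of_anarchy_def
    using assms(2) by (intro Inf_le_Sup) auto
qed

section \<open>The lower bound\<close>

text \<open>The bonus \<open>\<epsilon>\<close> on the middle edge makes \<open>b\<close> and
  \<open>c\<close> strictly prefer each other; with \<open>\<epsilon> = 0\<close> the optimum on the
  outer edges would itself be a pairwise equilibrium.\<close>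

definition path_game :: "'v \<Rightarrow> 'v \<Rightarrow> 'v \<Rightarrow> 'v \<Rightarrow> real \<Rightarrow> 'v contribution_game" where
  "path_game a b c d \<epsilon> =
     \<lparr>verts = {a, b, c, d}, edges = {{a, b}, {b, c}, {c, d}}, budget = (\<lambda>_. 1),
      reward = (\<lambda>e x y. (if e = {b, c} then 1 + \<epsilon> else 1) * min x y)\<rparr>"

locale path4 =
  fixes a b c d :: 'v and \<epsilon> :: real
  assumes distinct: "distinct [a, b, c, d]" and eps_pos: "0 < \<epsilon>"
begin

abbreviation "P \<equiv> path_game a b c d \<epsilon>"

lemma neq: "a \<noteq> b" "a \<noteq> c" "a \<noteq> d" "b \<noteq> c" "b \<noteq> d" "c \<noteq> d"
  "b \<noteq> a" "c \<noteq> a" "d \<noteq> a" "c \<noteq> b" "d \<noteq> b" "d \<noteq> c"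
  using distinct by auto

lemma path_in_class: "P \<in> uniform_convex_games" "normalized_budgets P"
proof -
  have "contribution_game P"
    using neq eps_pos by (auto simp: contribution_game_def path_game_def)
  moreover have "convex_min_effort P"
    unfolding convex_min_effort_def
  proof
    fix e
    let ?k = "if e = {b, c} then 1 + \<epsilon> else 1"
    have "convex_on {0..} (\<lambda>x. ?k * x)"
      by (rule convex_onI) (auto simp: algebra_simps)
    then show "\<exists>h :: real \<Rightarrow> real. (\<forall>x\<ge>0. 0 \<le> h x) \<and> mono_on {0..} h \<and> convex_on {0..} h \<and>
        (\<forall>x\<ge>0. \<forall>y\<ge>0. reward P e x y = h (min x y))"
      using eps_pos
      by (intro exI[of _ "\<lambda>x. ?k * x"]) (auto simp: path_game_def mono_on_def)
  qed
  moreover have "normalized_budgets P" "uniform_budgets P"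
    by (auto simp: normalized_budgets_def uniform_budgets_def path_game_def)
  ultimately show "P \<in> uniform_convex_games" "normalized_budgets P"
    by (auto simp: uniform_convex_games_def)
qed

section \<open>Strategies, utilities and welfare on the path\<close>

lemma nbrs_path:
  "{u. {a, u} \<in> edges P} = {b}" "{u. {b, u} \<in> edges P} = {a, c}"
  "{u. {c, u} \<in> edges P} = {b, d}" "{u. {d, u} \<in> edges P} = {c}"
  using neq by (auto simp: path_game_def doubleton_eq_iff)

lemma incident_path:
  "incident P a = {{a, b}}" "incident P b = {{a, b}, {b, c}}"
  "incident P c = {{b, c}, {c, d}}" "incident P d = {{c, d}}"
  using neq by (auto simp: path_game_def incident_def)

lemma strategy_path:
  "strategy P a x \<longleftrightarrow> 0 \<le> x {a, b} \<and> x {a, b} \<le> 1"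
  "strategy P b x \<longleftrightarrow> 0 \<le> x {a, b} \<and> 0 \<le> x {b, c} \<and> x {a, b} + x {b, c} \<le> 1"
  "strategy P c x \<longleftrightarrow> 0 \<le> x {b, c} \<and> 0 \<le> x {c, d} \<and> x {b, c} + x {c, d} \<le> 1"
  "strategy P d x \<longleftrightarrow> 0 \<le> x {c, d} \<and> x {c, d} \<le> 1"
  unfolding strategy_def incident_path using neq
  by (auto simp: doubleton_eq_iff path_game_def)

lemma utility_path:
  "utility P s a = min (s a {a, b}) (s b {a, b})"
  "utility P s b = min (s a {a, b}) (s b {a, b}) + (1 + \<epsilon>) * min (s b {b, c}) (s c {b, c})"
  "utility P s c = (1 + \<epsilon>) * min (s b {b, c}) (s c {b, c}) + min (s c {c, d}) (s d {c, d})"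
  "utility P s d = min (s c {c, d}) (s d {c, d})"
  unfolding utility_def nbrs_path using neq
  by (auto simp: path_game_def doubleton_eq_iff insert_commute min.commute)

lemma verts_path: "verts P = {a, b, c, d}"
  by (simp add: path_game_def)

lemma state_path:
  "state P s \<longleftrightarrow> strategy P a (s a) \<and> strategy P b (s b) \<and> strategy P c (s c) \<and> strategy P d (s d)"
  by (auto simp: state_def verts_path)

lemma welfare_path:
  "welfare P s = utility P s a + utility P s b + utility P s c + utility P s d"
  using neq by (simp add: welfare_def verts_path)

section \<open>Equilibria and optimum of the path\<close>

lemma utility_path_le:
  assumes "state P s"
  shows "utility P s b \<le> 1 + \<epsilon>" "utility P s c \<le> 1 + \<epsilon>"
proof -
  \<comment> \<open>A unit budget split between edges of slope \<open>1\<close> and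
    \<open>1 + \<epsilon>\<close> earns most on the steeper one.\<close>
  have *: "p + (1 + \<epsilon>) * q \<le> 1 + \<epsilon>" if "0 \<le> p" "p + q \<le> 1" for p q :: real
  proof -
    have "p + (1 + \<epsilon>) * q \<le> (1 + \<epsilon>) * (p + q)"
      using that eps_pos by (simp add: algebra_simps)
    also have "\<dots> \<le> (1 + \<epsilon>) * 1"
      using that eps_pos by (intro mult_left_mono) auto
    finally show ?thesis by simp
  qed
  show "utility P s b \<le> 1 + \<epsilon>" "utility P s c \<le> 1 + \<epsilon>"
    using assms unfolding utility_path state_path strategy_path
     by (auto simp: add.commute[of "(1 + \<epsilon>) * _"] intro!: *)
qed

lemma path_equilibrium_exists: "\<exists>s. pairwise_equilibrium P s"
proof -
  \<comment> \<open>Both middle players spend everything on \<open>{b, c}\<close> and reach their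
    maximum \<open>1 + \<epsilon>\<close>.\<close>
  define s where "s = (\<lambda>(v::'v) e. if e = {b, c} then 1 else (0::real))"
  have s_simps: "s v {b, c} = 1" "s v {a, b} = 0" "s v {c, d} = 0" for v
    using neq by (auto simp: s_def doubleton_eq_iff)
  have s: "state P s"
    by (simp add: state_path strategy_path s_simps)
  have s_upd: "state P (s(v := x))" if "strategy P v x" for v x
    using s that by (auto simp: state_def)
  have s_upd2: "state P (s(u := x, v := y))" if "strategy P u x" "strategy P v y" for u v x y
    using s that by (auto simp: state_def)
  have s_util: "utility P s b = 1 + \<epsilon>" "utility P s c = 1 + \<epsilon>"
    by (simp_all add: utility_path s_simps)
  \<comment> \<open>The outer players gain nothing while \<open>b\<close> and \<open>c\<close> keep
    their strategies, the middle ones gain nothing in any state.\<close>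
  have s_best: "utility P t v \<le> utility P s v"
    if "v \<in> verts P" "state P t" "t b = s b \<and> t c = s c \<or> v \<in> {b, c}" for t v
    using that utility_path_le[OF that(2)] s_util
    by (auto simp: verts_path utility_path(1,4) s_simps)
  have "nash_equilibrium P s"
    unfolding nash_equilibrium_def
  proof (intro conjI s ballI allI impI)
    fix v x assume "v \<in> verts P" "strategy P v x"
    then show "utility P (s(v := x)) v \<le> utility P s v"
      by (intro s_best s_upd) auto
  qed
  moreover have "\<not> improving_bilateral_deviation P s u x v y" for u x v y
  proof
    assume dev: "improving_bilateral_deviation P s u x v y"
    let ?t = "s(u := x, v := y)"
    have "u \<in> verts P" "v \<in> verts P" "state P ?t" "u \<noteq> v"
      "utility P s u < utility P ?t u" "utility P s v < utility P ?t v"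
      using dev s_upd2 by (auto simp: improving_bilateral_deviation_def)
    \<comment> \<open>A deviating pair could thus only be \<open>a\<close> and \<open>d\<close>,
      which leaves \<open>b\<close> and \<open>c\<close> unchanged.\<close>
    moreover from this have "u \<notin> {b, c}" "v \<notin> {b, c}"
      using s_best[of u ?t] s_best[of v ?t] by fastforce+
    ultimately show False
      using s_best[of u ?t] by auto
  qed
  ultimately show ?thesis
    by (auto simp: pairwise_equilibrium_def)
qed

text \<open>Unless \<open>b\<close> or \<open>c\<close> already earns \<open>1 + \<epsilon>\<close>,
  moving together to \<open>{b, c}\<close> improves both. Earning it forces the full unit onto the
  middle edge, and nothing is left for the outer ones.\<close>

lemma path_equilibrium_welfare:
  assumes "pairwise_equilibrium P s"
  shows "welfare P s = 2 * (1 + \<epsilon>)"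
proof -
  have s: "state P s"
    using assms by (auto simp: pairwise_equilibrium_def nash_equilibrium_def)
  define x where "x = (\<lambda>e. if e = {b, c} then 1 else (0::real))"
  let ?t = "s(b := x, c := x)"
  have x_simps: "x {b, c} = 1" "x {a, b} = 0" "x {c, d} = 0"
    using neq by (auto simp: x_def doubleton_eq_iff)
  have x: "strategy P b x" "strategy P c x"
    by (simp_all add: strategy_path x_simps)
  define p q r where "p = min (s a {a, b}) (s b {a, b})"
    and "q = min (s b {b, c}) (s c {b, c})" and "r = min (s c {c, d}) (s d {c, d})"
  have pqr: "0 \<le> p" "0 \<le> q" "0 \<le> r" "p + q \<le> 1" "q + r \<le> 1"
    using s unfolding state_path strategy_path p_def q_def r_def by (auto simp: min_def)
  have "\<not> improving_bilateral_deviation P s b x c x"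
    using assms by (auto simp: pairwise_equilibrium_def)
  then have "utility P ?t b \<le> utility P s b \<or> utility P ?t c \<le> utility P s c"
    using x neq by (auto simp: improving_bilateral_deviation_def verts_path)
  moreover have "utility P ?t b = 1 + \<epsilon>" "utility P ?t c = 1 + \<epsilon>"
    using neq s unfolding utility_path state_path strategy_path by (simp_all add: x_simps min_def)
  ultimately have "1 + \<epsilon> \<le> p + (1 + \<epsilon>) * q \<or> 1 + \<epsilon> \<le> (1 + \<epsilon>) * q + r"
    unfolding utility_path p_def q_def r_def by auto
  \<comment> \<open>Insert \<open>p \<le> 1 - q\<close> or \<open>r \<le> 1 - q\<close>, from the
    budgets of \<open>b\<close> and \<open>c\<close>; the factor \<open>1\<close> prepares
    cancelling \<open>\<epsilon>\<close>.\<close>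
  then have "\<epsilon> * 1 \<le> \<epsilon> * q"
    using pqr by (auto simp: algebra_simps)
  then have "q = 1"
    using eps_pos pqr by (auto simp: mult_le_cancel_left)
  moreover from this have "p = 0" "r = 0"
    using pqr by auto
  ultimately show ?thesis
    unfolding welfare_path utility_path p_def[symmetric] q_def[symmetric] r_def[symmetric] by simp
qed

lemma path_optimum_welfare:
  assumes "social_optimum P t"
  shows "4 \<le> welfare P t"
proof -
  \<comment> \<open>Each outer edge is used fully and pays \<open>1\<close> to both endpoints. A
    lower bound suffices; for \<open>\<epsilon> > 1\<close> the optimum is larger.\<close>
  define s where "s = (\<lambda>(v::'v) e. if e = {b, c} then 0 else (1::real))"
  have s_simps: "s v {b, c} = 0" "s v {a, b} = 1" "s v {c, d} = 1" for v
    using neq by (auto simp: s_def doubleton_eq_iff)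
  have "state P s"
    by (simp add: state_path strategy_path s_simps)
  moreover have "welfare P s = 4"
    by (simp add: welfare_path utility_path s_simps)
  ultimately show ?thesis
    using assms by (auto simp: social_optimum_def)
qed

text \<open>All equilibria have the same welfare, so even the best ratio is at least
  \<open>4 / (2 * (1 + \<epsilon>))\<close>.\<close>

lemma path_price_of_stability_ge: "ennreal (2 / (1 + \<epsilon>)) \<le> price_of_stability P"
  unfolding price_of_stability_def
proof (rule Inf_greatest)
  fix r assume "r \<in> {welfare_ratio (welfare P t) (welfare P s) | t s.
    social_optimum P t \<and> pairwise_equilibrium P s}"
  then obtain t s where r: "r = welfare_ratio (welfare P t) (welfare P s)"
    and "social_optimum P t" "pairwise_equilibrium P s"
    by auto
  then have w: "4 \<le> welfare P t" "welfare P s = 2 * (1 + \<epsilon>)"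
    by (simp_all add: path_optimum_welfare path_equilibrium_welfare)
  then have "r = ennreal (welfare P t / (2 * (1 + \<epsilon>)))"
    using eps_pos by (simp add: r welfare_ratio_def divide_ennreal del: distrib_left_numeral)
  moreover have "2 / (1 + \<epsilon>) \<le> welfare P t / (2 * (1 + \<epsilon>))"
    using frac_le[OF _ w(1), of "2 * (1 + \<epsilon>)" "2 * (1 + \<epsilon>)"] w(1) eps_pos
    by (simp add: divide_simps del: distrib_left_numeral)
  ultimately show "ennreal (2 / (1 + \<epsilon>)) \<le> r"
    by (simp add: ennreal_leI)
qed

end

section \<open>Prices of a class of games\<close>

text \<open>Stated for any class between the path games and \<open>uniform_convex_games\<close>, to
  cover both uniform and normalized budgets. The stability price lies below the anarchy price, and
  both are squeezed to \<open>2\<close>.\<close>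

lemma class_prices_eq_2:
  assumes sub: "\<C> \<subseteq> uniform_convex_games"
    and path: "\<And>\<epsilon>. 0 < \<epsilon> \<Longrightarrow> path_game a b c d \<epsilon> \<in> \<C>"
    and dist: "distinct [a, b, c, d]"
  shows "class_price_of_anarchy \<C> = 2 \<and> class_price_of_stability \<C> = 2"
proof -
  have "class_price_of_anarchy \<C> \<le> 2"
    unfolding class_price_of_anarchy_def
    using sub price_of_anarchy_le by (intro SUP_least) auto
  moreover have "class_price_of_stability \<C> \<le> class_price_of_anarchy \<C>"
    unfolding class_price_of_anarchy_def class_price_of_stability_def
    using sub price_of_stability_le_anarchy by (intro SUP_mono) blast
  moreover have "2 \<le> class_price_of_stability \<C>"
  \<comment> \<open>A single path game gives only \<open>2 / (1 + \<epsilon>) < 2\<close>; the bound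
    \<open>2\<close> arises as \<open>\<epsilon>\<close> tends to \<open>0\<close> from the
    right.\<close>
  proof (rule tendsto_upperbound)
    have "((\<lambda>\<epsilon>. 2 / (1 + \<epsilon>)) \<longlongrightarrow> 2 / (1 + 0)) (at_right (0::real))"
      by (intro tendsto_intros) auto
    then have "((\<lambda>\<epsilon>. ennreal (2 / (1 + \<epsilon>))) \<longlongrightarrow> ennreal 2) (at_right 0)"
      by (intro tendsto_ennrealI) simp
    then show "((\<lambda>\<epsilon>. ennreal (2 / (1 + \<epsilon>))) \<longlongrightarrow> 2) (at_right 0)"
      by simp
    have "ennreal (2 / (1 + \<epsilon>)) \<le> class_price_of_stability \<C>" if "0 < \<epsilon>" for \<epsilon> :: real
    proof -
      interpret path4 a b c d \<epsilon>
        using dist that by unfold_locales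
      have "price_of_stability P \<le> class_price_of_stability \<C>"
        unfolding class_price_of_stability_def
        using path[OF that] path_equilibrium_exists by (intro SUP_upper) auto
      then show ?thesis
        using path_price_of_stability_ge by (rule order_trans[rotated])
    qed
    then show "\<forall>\<^sub>F \<epsilon> in at_right 0. ennreal (2 / (1 + \<epsilon>)) \<le> class_price_of_stability \<C>"
      by (auto simp: eventually_at_filter)
  qed simp
  ultimately show ?thesis
    by auto
qed

theorem theorem4p3:
  assumes "infinite (UNIV :: 'v set)"
  shows "class_price_of_anarchy (uniform_convex_games :: 'v contribution_game set) = 2 \<and>
         class_price_of_stability (uniform_convex_games :: 'v contribution_game set) = 2 \<and>
         class_price_of_anarchy
           {G \<in> (uniform_convex_games :: 'v contribution_game set). normalized_budgets G} = 2 \<and>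
         class_price_of_stability
           {G \<in> (uniform_convex_games :: 'v contribution_game set). normalized_budgets G} = 2"
proof -
  obtain S :: "'v set" where "finite S" "card S = 4"
    using infinite_arbitrarily_large[OF assms] by blast
  moreover from this obtain xs where "set xs = S" "distinct xs"
    using finite_distinct_list by blast
  ultimately have "distinct xs" "length xs = 4"
    using distinct_card[of xs] by auto
  then obtain a b c d :: 'v where dist: "distinct [a, b, c, d]"
    by (auto simp: numeral_eq_Suc length_Suc_conv)
  have "path_game a b c d \<epsilon> \<in> uniform_convex_games" "normalized_budgets (path_game a b c d \<epsilon>)"
    if "0 < \<epsilon>" for \<epsilon>
    using path4.path_in_class[of a b c d \<epsilon>] dist that by (auto simp: path4_def)
  then show ?thesis
    using class_prices_eq_2[OF _ _ dist, of uniform_convex_games]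
      class_prices_eq_2[OF _ _ dist, of "{G \<in> uniform_convex_games. normalized_budgets G}"]
    by auto
qed

end
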